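(* In the homogeneous data setting described in the context, for $q=1$ and $r_i=\frac1n$ we have $$\mathbb{E}\big[H_1(\mathbf{x})\big]=\frac{1}{2n}\sum_{i=1}^n \mathbb{E}\big[f_i(\mathbf{x})\big]^2+\frac{n}{n-1}\,\mathbb{E}\left[\frac{1}{2n}\sum_{i=1}^n\big(f_i(\mathbf{x})-F(\mathbf{x})\big)^2\right].$$ If $\mathbb{E}[f_i(\mathbf{x})]\le C$ for all $i$ and some constant $C$, then $$\mathbb{E}[H_1(\mathbf{x})]\le \mathbb{E}[L_\lambda(\mathbf{x})],\qquad\text{with } \lambda=\frac{n}{C(n-1)}.$$
   Context: There are $n$ clients. Client $i$ holds a dataset $\mathcal{S}_i=\{\xi_i^1,\dots,\xi_i^{N_i}\}\sim\mathcal{D}_i^{N_i}$ of $N_i$ samples from its data distribution $\mathcal{D}_i$. Homogeneous data means that the datasets of all $n$ clients are drawn from the same underlying distribution, i.e. $\mathcal{D}_i=\mathcal{D}_j$ for all $i,j\in\{1,\dots,n\}$. For model parameters $\mathbf{x}\in\mathbb{R}^d$ and a loss function $\ell(\mathbf{x},\xi)$, set $f_i(\mathbf{x})=\frac{1}{N_i}\sum_{j=1}^{N_i}\ell(\mathbf{x},\xi_i^j)$ (the local loss of client $i$) and $F(\mathbf{x})=\frac1n\sum_{i=1}^n f_i(\mathbf{x})$ (the average loss). Expectations are over the random datasets, and $\mathbb{E}[f_i(\mathbf{x})]^2$ means $(\mathbb{E}[f_i(\mathbf{x})])^2$. For weights $r_i$ and a parameter $q$, $H_q(\mathbf{x})=\sum_{i=1}^n\frac{r_i}{q+1}\big(f_i(\mathbf{x})\big)^{q+1}$.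 For a parameter $\lambda$, $L_\lambda(\mathbf{x})=F(\mathbf{x})+\frac{\lambda}{2n}\sum_{i=1}^n\big(f_i(\mathbf{x})-F(\mathbf{x})\big)^2$.
   Formalization: The inequality is false as printed (constant loss 4, C=4: 8≤4; constant loss −1, C=1: 1/2≤−1). It is proved for 0≤E[f_i(x)]≤C with 0<C≤1; for every C>0, E[H_1]≤C·E[L_λ] is proved instead. Datasets are independent across clients, the loss square integrable, n≥2. *)

theory Defs
  imports "HOL-Probability.Probability"
begin

text \<open>
  A realisation of all datasets is a function \<open>s\<close>, where \<open>s i j\<close> (\<open>1 \<le> j \<le> N i\<close>) is the
  \<open>j\<close>-th sample of client \<open>i\<close> (\<open>1 \<le> i \<le> n\<close>); \<open>l x z\<close> is the loss of the parameters \<open>x\<close> at the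
  sample \<open>z\<close>. The randomness enters only when \<open>s\<close> is instantiated with a random family of datasets.
\<close>

definition local_loss ::
  "('p \<Rightarrow> 'a \<Rightarrow> real) \<Rightarrow> (nat \<Rightarrow> nat) \<Rightarrow> (nat \<Rightarrow> nat \<Rightarrow> 'a) \<Rightarrow> nat \<Rightarrow> 'p \<Rightarrow> real" where
  "local_loss l N s i x = (1 / real (N i)) * (\<Sum>j=1..N i. l x (s i j))"

definition average_loss ::
  "nat \<Rightarrow> ('p \<Rightarrow> 'a \<Rightarrow> real) \<Rightarrow> (nat \<Rightarrow> nat) \<Rightarrow> (nat \<Rightarrow> nat \<Rightarrow> 'a) \<Rightarrow> 'p \<Rightarrow> real" where
  "average_loss n l N s x = (1 / real n) * (\<Sum>i=1..n. local_loss l N s i x)"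

text \<open>
  The exponent is real, hence \<open>powr\<close>. Since \<open>ln (- t) = ln t\<close> for real \<open>t\<close>,
  \<open>t powr a\<close> is \<open>\<bar>t\<bar> powr a\<close>; in particular \<open>t powr (1 + 1) = t\<^sup>2\<close> holds for negative \<open>t\<close> as well.
\<close>

definition H_objective ::
  "nat \<Rightarrow> (nat \<Rightarrow> real) \<Rightarrow> real \<Rightarrow> ('p \<Rightarrow> 'a \<Rightarrow> real) \<Rightarrow> (nat \<Rightarrow> nat) \<Rightarrow> (nat \<Rightarrow> nat \<Rightarrow> 'a) \<Rightarrow> 'p \<Rightarrow> real"
  where
  "H_objective n r q l N s x = (\<Sum>i=1..n. r i / (q + 1) * local_loss l N s i x powr (q + 1))"

definition L_objective ::
  "nat \<Rightarrow> real \<Rightarrow> ('p \<Rightarrow> 'a \<Rightarrow> real) \<Rightarrow> (nat \<Rightarrow> nat) \<Rightarrow> (nat \<Rightarrow> nat \<Rightarrow> 'a) \<Rightarrow> 'p \<Rightarrow> real" where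
  "L_objective n lam l N s x =
     average_loss n l N s x
     + lam / (2 * real n) * (\<Sum>i=1..n. (local_loss l N s i x - average_loss n l N s x)\<^sup>2)"

end

(*
  All local losses have the common mean m, so by independence the cross terms of E[(sum f_i)^2] equal
  m^2. This gives E[(1/2n) sum (f_i - F)^2] = (n-1)/n (E[H_1] - m^2/2), which is the identity.
  The inequalities follow from m^2/2 <= C m and, for C <= 1, from L >= 0 in expectation.
*)
theory Submission
  imports Defs
begin

section \<open>Square-integrable functions: products and finite sums\<close>

lemma integrable_mult_if_square_integrable:
  fixes f g :: "'a \<Rightarrow> real"
  assumes [measurable]: "f \<in> borel_measurable M" "g \<in> borel_measurable M"
    and "integrable M (\<lambda>x. (f x)\<^sup>2)" "integrable M (\<lambda>x. (g x)\<^sup>2)"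
  shows "integrable M (\<lambda>x. f x * g x)"
proof (rule Bochner_Integration.integrable_bound)
  show "integrable M (\<lambda>x. (f x)\<^sup>2 + (g x)\<^sup>2)"
    using assms by simp
  \<comment> \<open>AM-GM on absolute values makes the sum of the two squares an integrable majorant
    of the product.\<close>
  have "\<bar>a * b\<bar> \<le> a\<^sup>2 + b\<^sup>2" for a b :: real
  proof -
    have "2 * (\<bar>a\<bar> * \<bar>b\<bar>) \<le> a\<^sup>2 + b\<^sup>2"
      using sum_squares_bound[of "\<bar>a\<bar>" "\<bar>b\<bar>"] by simp
    moreover have "0 \<le> \<bar>a\<bar> * \<bar>b\<bar>"
      by simp
    ultimately show ?thesis
      unfolding abs_mult by linarith
  qed
  then show "AE x in M. norm (f x * g x) \<le> norm ((f x)\<^sup>2 + (g x)\<^sup>2)"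
    by simp
qed measurable

lemma square_integrable_sum:
  fixes f :: "'i \<Rightarrow> 'a \<Rightarrow> real"
  assumes "\<And>i. i \<in> I \<Longrightarrow> f i \<in> borel_measurable M"
    and "\<And>i. i \<in> I \<Longrightarrow> integrable M (\<lambda>x. (f i x)\<^sup>2)"
  shows "integrable M (\<lambda>x. (\<Sum>i\<in>I. f i x)\<^sup>2)"
  unfolding power2_eq_square sum_product
  using assms
  by (intro Bochner_Integration.integrable_sum integrable_mult_if_square_integrable) auto

section \<open>Second moments of sums of independent variables\<close>

lemma (in prob_space) expectation_mult_indep_vars:
  fixes X :: "'i \<Rightarrow> 'a \<Rightarrow> real"
  assumes "indep_vars (\<lambda>_. borel) X I" "i \<in> I" "j \<in> I" "i \<noteq> j"
    and "integrable M (X i)" "integrable M (X j)"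
  shows "expectation (\<lambda>w. X i w * X j w) = expectation (X i) * expectation (X j)"
proof -
  have "indep_vars (\<lambda>_. borel) X {i, j}"
    using assms(1-3) by (intro indep_vars_subset[OF assms(1)]) auto
  then have "expectation (\<lambda>w. \<Prod>k\<in>{i, j}. X k w) = (\<Prod>k\<in>{i, j}. expectation (X k))"
    using assms(5,6) by (intro indep_vars_lebesgue_integral) auto
  then show ?thesis
    using \<open>i \<noteq> j\<close> by simp
qed

text \<open>Expand the square into a double sum with \<open>k = card I\<close>. The diagonal gives
  the second moments, and each of the \<open>k * (k - 1)\<close> ordered off-diagonal pairs
  contributes \<open>m * m\<close> by independence.\<close>

lemma (in prob_space) expectation_square_sum_indep_vars:
  fixes X :: "'i \<Rightarrow> 'a \<Rightarrow> real"
  assumes fin: "finite I"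
    and indep: "indep_vars (\<lambda>_. borel) X I"
    and sq: "\<And>i. i \<in> I \<Longrightarrow> integrable M (\<lambda>w. (X i w)\<^sup>2)"
    and mean: "\<And>i. i \<in> I \<Longrightarrow> expectation (X i) = m"
  shows "expectation (\<lambda>w. (\<Sum>i\<in>I. X i w)\<^sup>2)
    = (\<Sum>i\<in>I. expectation (\<lambda>w. (X i w)\<^sup>2)) + real (card I) * (real (card I) - 1) * m\<^sup>2"
proof -
  have meas: "X i \<in> borel_measurable M" if "i \<in> I" for i
    using indep that unfolding indep_vars_def2 by simp
  have int: "integrable M (X i)" if "i \<in> I" for i
    using square_integrable_imp_integrable[OF meas[OF that] sq[OF that]] .
  have int2: "integrable M (\<lambda>w. X i w * X j w)" if "i \<in> I" "j \<in> I" for i j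
    using that by (intro integrable_mult_if_square_integrable meas sq)
  have "expectation (\<lambda>w. (\<Sum>i\<in>I. X i w)\<^sup>2)
      = (\<Sum>i\<in>I. \<Sum>j\<in>I. expectation (\<lambda>w. X i w * X j w))"
    unfolding power2_eq_square sum_product using int2 by (simp add: Bochner_Integration.integral_sum)
  also have "\<dots> = (\<Sum>i\<in>I. expectation (\<lambda>w. (X i w)\<^sup>2) + (real (card I) - 1) * m\<^sup>2)"
  proof (rule sum.cong)
    fix i assume i: "i \<in> I"
    \<comment> \<open>Lets the natural-number difference \<open>card I - 1\<close>, the size of
      \<open>I - {i}\<close>, be read as a real difference.\<close>
    then have "1 \<le> card I"
      using fin by (metis One_nat_def Suc_leI card_gt_0_iff empty_iff)
    have "(\<Sum>j\<in>I. expectation (\<lambda>w. X i w * X j w))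
        = expectation (\<lambda>w. X i w * X i w) + (\<Sum>j\<in>I - {i}. expectation (\<lambda>w. X i w * X j w))"
      using fin i by (rule sum.remove)
    also have "(\<Sum>j\<in>I - {i}. expectation (\<lambda>w. X i w * X j w)) = (\<Sum>j\<in>I - {i}. m\<^sup>2)"
    proof (rule sum.cong)
      fix j assume "j \<in> I - {i}"
      then show "expectation (\<lambda>w. X i w * X j w) = m\<^sup>2"
        using i expectation_mult_indep_vars[OF indep, of i j] int mean by (auto simp: power2_eq_square)
    qed simp
    also have "\<dots> = (real (card I) - 1) * m\<^sup>2"
      using fin i \<open>1 \<le> card I\<close> by (simp add: of_nat_diff)
    finally show "(\<Sum>j\<in>I. expectation (\<lambda>w. X i w * X j w))
        = expectation (\<lambda>w. (X i w)\<^sup>2) + (real (card I) - 1) * m\<^sup>2"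
      by (simp add: power2_eq_square)
  qed simp
  finally show ?thesis
    by (simp add: sum.distrib)
qed

section \<open>Squared deviations from the average\<close>

lemma sum_square_deviation_eq:
  fixes a :: "'i \<Rightarrow> real"
  assumes "finite I" "I \<noteq> {}"
  shows "(\<Sum>i\<in>I. (a i - 1 / real (card I) * (\<Sum>j\<in>I. a j))\<^sup>2)
    = (\<Sum>i\<in>I. (a i)\<^sup>2) - (\<Sum>i\<in>I. a i)\<^sup>2 / real (card I)"
proof -
  define k where "k = real (card I)"
  define s where "s = (\<Sum>i\<in>I. a i)"
  have "k \<noteq> 0"
    using assms by (simp add: k_def)
  \<comment> \<open>After summation the cross term is \<open>- 2 * s * s / k\<close> and the
    constant term is \<open>s * s / k\<close>, so one copy of \<open>- s * s / k\<close>
    survives.\<close>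
  have "(\<Sum>i\<in>I. (a i - 1 / k * s)\<^sup>2) = (\<Sum>i\<in>I. (a i)\<^sup>2 - 2 * s / k * a i + (s / k)\<^sup>2)"
    by (intro sum.cong refl) (simp add: power2_diff)
  also have "\<dots> = (\<Sum>i\<in>I. (a i)\<^sup>2) - 2 * s / k * s + k * (s / k)\<^sup>2"
    by (simp add: sum.distrib sum_subtractf k_def s_def flip: sum_distrib_left sum_divide_distrib)
  also have "\<dots> = (\<Sum>i\<in>I. (a i)\<^sup>2) - s\<^sup>2 / k"
    using \<open>k \<noteq> 0\<close> by (simp add: power2_eq_square)
  finally show ?thesis
    unfolding k_def s_def .
qed

text \<open>With \<open>k = card I\<close> and \<open>A\<close> the sum of the second moments, the
  two previous results give \<open>A - (A + k * (k - 1) * m * m) / k\<close>. Integrability is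
  recorded as well, so that the expectation of \<open>L_objective\<close> can later be
  split.\<close>

lemma (in prob_space) expectation_sum_square_deviation:
  fixes X :: "'i \<Rightarrow> 'a \<Rightarrow> real"
  assumes "finite I" "I \<noteq> {}"
    and indep: "indep_vars (\<lambda>_. borel) X I"
    and sq: "\<And>i. i \<in> I \<Longrightarrow> integrable M (\<lambda>w. (X i w)\<^sup>2)"
    and mean: "\<And>i. i \<in> I \<Longrightarrow> expectation (X i) = m"
  shows "expectation (\<lambda>w. \<Sum>i\<in>I. (X i w - 1 / real (card I) * (\<Sum>j\<in>I. X j w))\<^sup>2)
      = (real (card I) - 1) / real (card I) * (\<Sum>i\<in>I. expectation (\<lambda>w. (X i w)\<^sup>2))
        - (real (card I) - 1) * m\<^sup>2" (is ?E)
    and "integrable M (\<lambda>w. \<Sum>i\<in>I. (X i w - 1 / real (card I) * (\<Sum>j\<in>I. X j w))\<^sup>2)" (is ?I)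
proof -
  have meas: "X i \<in> borel_measurable M" if "i \<in> I" for i
    using indep that unfolding indep_vars_def2 by simp
  have card: "real (card I) \<noteq> 0"
    using assms(1,2) by simp
  have int: "integrable M (\<lambda>w. (\<Sum>i\<in>I. X i w)\<^sup>2)"
    using meas sq by (rule square_integrable_sum)
  show ?I
    unfolding sum_square_deviation_eq[OF assms(1,2)] using int sq by simp
  show ?E
    unfolding sum_square_deviation_eq[OF assms(1,2)]
    using int sq card expectation_square_sum_indep_vars[OF assms(1) indep sq mean]
    by (simp add: Bochner_Integration.integral_sum field_simps)
qed

section \<open>Moments of an empirical mean under the product distribution\<close>

lemma integrable_PiM_component:
  fixes g :: "'a \<Rightarrow> real"
  assumes "\<And>i. i \<in> I \<Longrightarrow> prob_space (D i)" "j \<in> I" "g \<in> borel_measurable (D j)"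
  shows "integrable (PiM I D) (\<lambda>t. g (t j)) \<longleftrightarrow> integrable (D j) g"
    and "(\<integral>t. g (t j) \<partial>PiM I D) = (\<integral>z. g z \<partial>D j)"
  \<comment> \<open>Projection to coordinate \<open>j\<close> pushes the product measure forward to
    \<open>D j\<close>; both claims are then a change of variables.\<close>
  using assms
    integrable_distr_eq[OF measurable_component_singleton[OF assms(2), of D] assms(3)]
    integral_distr[OF measurable_component_singleton[OF assms(2), of D] assms(3)]
    distr_PiM_component[of I D, OF assms(1,2)]
  by simp_all

text \<open>Supplies the moments of a client's local loss, with \<open>g\<close> the loss at fixed
  parameters. The mean follows from linearity alone; \<open>k \<ge> 1\<close> matters there, since
  for \<open>k = 0\<close> division by zero would make \<open>h\<close> constantly 0.\<close>

lemma empirical_mean_PiM: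
  fixes g :: "'a \<Rightarrow> real"
  assumes D: "prob_space D" and g: "g \<in> borel_measurable D" "integrable D (\<lambda>z. (g z)\<^sup>2)"
    and k: "k \<ge> 1"
  defines "P \<equiv> PiM {1..k} (\<lambda>_. D)" and "h \<equiv> \<lambda>t. 1 / real k * (\<Sum>j=1..k. g (t j))"
  shows "h \<in> borel_measurable P" and "integrable P (\<lambda>t. (h t)\<^sup>2)"
    and "(\<integral>t. h t \<partial>P) = (\<integral>z. g z \<partial>D)"
proof -
  interpret D: prob_space D by (rule D)
  have meas: "(\<lambda>t. g (t j)) \<in> borel_measurable P" if "j \<in> {1..k}" for j
    using that g(1) unfolding P_def by measurable
  have "integrable P (\<lambda>t. (g (t j))\<^sup>2)" if "j \<in> {1..k}" for j
    using integrable_PiM_component(1)[of "{1..k}" "\<lambda>_. D" j "\<lambda>z. (g z)\<^sup>2"] that D g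
    unfolding P_def by simp
  with meas have "integrable P (\<lambda>t. (\<Sum>j=1..k. g (t j))\<^sup>2)"
    by (rule square_integrable_sum)
  then show "integrable P (\<lambda>t. (h t)\<^sup>2)"
    unfolding h_def power_mult_distrib by simp
  show "h \<in> borel_measurable P"
    unfolding h_def using meas by simp
  have "integrable D g"
    using g by (rule D.square_integrable_imp_integrable)
  then have "integrable P (\<lambda>t. g (t j))" "(\<integral>t. g (t j) \<partial>P) = (\<integral>z. g z \<partial>D)" if "j \<in> {1..k}" for j
    using integrable_PiM_component[of "{1..k}" "\<lambda>_. D" j g] that D g
    unfolding P_def by simp_all
  then show "(\<integral>t. h t \<partial>P) = (\<integral>z. g z \<partial>D)"
    unfolding h_def using k by (simp add: Bochner_Integration.integral_sum)
qed

text \<open>The form of the bounds is dictated by counterexamples. A constant negative loss has zero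
  deviation, a positive expected \<open>H_objective\<close> and a negative expected
  \<open>L_objective\<close>, hence the condition that the means be nonnegative. For
  \<open>C > 1\<close>, a loss of mean 0 with positive variance violates the bound without the
  factor \<open>C\<close>, because lambda shrinks the deviation term by \<open>1 / C\<close>; hence
  that bound is claimed for \<open>C \<le> 1\<close>, and the one with factor \<open>C\<close> for
  every positive \<open>C\<close>.\<close>

theorem theorem1:
  fixes n :: nat
    and N :: "nat \<Rightarrow> nat"
    and D :: "nat \<Rightarrow> 'a measure"
    and M :: "'w measure"
    and S :: "'w \<Rightarrow> nat \<Rightarrow> nat \<Rightarrow> 'a"
    and l :: "real ^ 'd \<Rightarrow> 'a \<Rightarrow> real"
    and x :: "real ^ 'd"
  assumes "n \<ge> 2"
    and "\<And>i. i \<in> {1..n} \<Longrightarrow> N i \<ge> 1"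
    and "prob_space M"
    and "\<And>i. i \<in> {1..n} \<Longrightarrow> prob_space (D i)"
    and homogeneous: "\<And>i j. i \<in> {1..n} \<Longrightarrow> j \<in> {1..n} \<Longrightarrow> D i = D j"
    and datasets_independent:
      "prob_space.indep_vars M (\<lambda>i. PiM {1..N i} (\<lambda>_. D i)) (\<lambda>i w. S w i) {1..n}"
    and datasets_distribution:
      "\<And>i. i \<in> {1..n} \<Longrightarrow>
         distr M (PiM {1..N i} (\<lambda>_. D i)) (\<lambda>w. S w i) = PiM {1..N i} (\<lambda>_. D i)"
    and loss_measurable: "\<And>i. i \<in> {1..n} \<Longrightarrow> l x \<in> borel_measurable (D i)"
    and loss_square_integrable: "\<And>i. i \<in> {1..n} \<Longrightarrow> integrable (D i) (\<lambda>z. (l x z)\<^sup>2)"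
  shows
    "(\<integral>w. H_objective n (\<lambda>_. 1 / real n) 1 l N (S w) x \<partial>M)
       = 1 / (2 * real n) * (\<Sum>i=1..n. (\<integral>w. local_loss l N (S w) i x \<partial>M)\<^sup>2)
         + real n / (real n - 1) *
           (\<integral>w. 1 / (2 * real n) *
              (\<Sum>i=1..n. (local_loss l N (S w) i x - average_loss n l N (S w) x)\<^sup>2) \<partial>M)
     \<and> (\<forall>C::real. C > 0 \<longrightarrow>
          (\<forall>i\<in>{1..n}. 0 \<le> (\<integral>w. local_loss l N (S w) i x \<partial>M)
                   \<and> (\<integral>w. local_loss l N (S w) i x \<partial>M) \<le> C) \<longrightarrow>
          (C \<le> 1 \<longrightarrow>
             (\<integral>w. H_objective n (\<lambda>_. 1 / real n) 1 l N (S w) x \<partial>M)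
               \<le> (\<integral>w. L_objective n (real n / (C * (real n - 1))) l N (S w) x \<partial>M))
          \<and> (\<integral>w. H_objective n (\<lambda>_. 1 / real n) 1 l N (S w) x \<partial>M)
               \<le> C * (\<integral>w. L_objective n (real n / (C * (real n - 1))) l N (S w) x \<partial>M))"
proof -
  interpret prob_space M by (rule assms(3))
  define f where "f i w = local_loss l N (S w) i x" for i w
  define m where "m = (\<integral>z. l x z \<partial>D 1)"
  define A where "A = (\<Sum>i=1..n. expectation (\<lambda>w. (f i w)\<^sup>2))"
  \<comment> \<open>Writing the local loss as a function of the dataset of client \<open>i\<close>
    alone lets independence and distribution of the datasets pass to the losses.\<close>
  define h where "h i t = 1 / real (N i) * (\<Sum>j=1..N i. l x (t j))" for i and t :: "nat \<Rightarrow> 'a"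
  have f_eq: "f i w = h i (S w i)" for i w
    by (simp add: f_def h_def local_loss_def)
  have D1: "D i = D 1" if "i \<in> {1..n}" for i
    using homogeneous[of i 1] that assms(1) by auto
  have S_meas: "(\<lambda>w. S w i) \<in> measurable M (PiM {1..N i} (\<lambda>_. D i))" if "i \<in> {1..n}" for i
    using datasets_independent that unfolding indep_vars_def2 by simp
  have h: "h i \<in> borel_measurable (PiM {1..N i} (\<lambda>_. D i))"
    "integrable (PiM {1..N i} (\<lambda>_. D i)) (\<lambda>t. (h i t)\<^sup>2)"
    "(\<integral>t. h i t \<partial>PiM {1..N i} (\<lambda>_. D i)) = m" if "i \<in> {1..n}" for i
    using empirical_mean_PiM[OF assms(4)[OF that] loss_measurable[OF that]
        loss_square_integrable[OF that] assms(2)[OF that]] D1[OF that]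
    unfolding h_def m_def by simp_all
  have indep: "indep_vars (\<lambda>_. borel) f {1..n}"
    using indep_vars_compose2[OF datasets_independent h(1)] unfolding f_eq[abs_def] by simp
  \<comment> \<open>Here and for the mean, a change of variables along the dataset map moves the
    claim from \<open>M\<close> to the product measure.\<close>
  have sq: "integrable M (\<lambda>w. (f i w)\<^sup>2)" if "i \<in> {1..n}" for i
    using h(1,2)[OF that] datasets_distribution[OF that]
      integrable_distr_eq[OF S_meas[OF that], of "\<lambda>t. (h i t)\<^sup>2"]
    unfolding f_eq by simp
  have mean: "expectation (f i) = m" if "i \<in> {1..n}" for i
    using h(1,3)[OF that] datasets_distribution[OF that]
      integral_distr[OF S_meas[OF that], of "h i"]
    unfolding f_eq[abs_def] by simp
  have int: "integrable M (f i)" if "i \<in> {1..n}" for i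
  proof (rule square_integrable_imp_integrable)
    show "f i \<in> borel_measurable M"
      using indep that unfolding indep_vars_def2 by simp
  qed (rule sq[OF that])
  define V where "V w = (\<Sum>i=1..n. (f i w - average_loss n l N (S w) x)\<^sup>2)" for w
  have average: "average_loss n l N (S w) x = 1 / real n * (\<Sum>j=1..n. f j w)" for w
    by (simp add: average_loss_def f_def)
  have EV: "expectation V = (real n - 1) / real n * A - (real n - 1) * m\<^sup>2"
    and V_int: "integrable M V"
    using expectation_sum_square_deviation[OF _ _ indep sq mean] assms(1)
    unfolding V_def[abs_def] average A_def by auto
  have "H_objective n (\<lambda>_. 1 / real n) 1 l N (S w) x = 1 / (2 * real n) * (\<Sum>i=1..n. (f i w)\<^sup>2)" for w
  proof -
    \<comment> \<open>Local losses may be negative; \<open>powr\<close> sees only the absolute value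
      because \<open>ln (- t) = ln t\<close>.\<close>
    have "t powr 2 = t\<^sup>2" for t :: real
    proof -
      have "t powr 2 = \<bar>t\<bar> powr 2"
        by (simp add: powr_def abs_if ln_minus)
      then show ?thesis
        by simp
    qed
    then show ?thesis
      by (simp add: H_objective_def f_def sum_distrib_left mult.commute)
  qed
  then have EH: "(\<integral>w. H_objective n (\<lambda>_. 1 / real n) 1 l N (S w) x \<partial>M) = 1 / (2 * real n) * A"
    using sq by (simp add: A_def Bochner_Integration.integral_sum)
  have EL: "(\<integral>w. L_objective n c l N (S w) x \<partial>M) = m + c / (2 * real n) * expectation V" for c
  proof -
    have "(\<integral>w. average_loss n l N (S w) x \<partial>M) = m"
      unfolding average using int mean assms(1) by (simp add: Bochner_Integration.integral_sum)
    moreover have "integrable M (\<lambda>w. average_loss n l N (S w) x)"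
      unfolding average using int by (intro integrable_mult_right Bochner_Integration.integrable_sum)
    ultimately show ?thesis
      unfolding L_objective_def f_def[symmetric] V_def[symmetric] using V_int by simp
  qed
  have n: "real n > 1"
    using assms(1) by simp
  \<comment> \<open>This is \<open>EV\<close> solved for \<open>A\<close>. The factor
    \<open>n / (n - 1)\<close> undoes the bias \<open>(n - 1) / n\<close> caused by centring at the
    average instead of at \<open>m\<close>.\<close>
  have EH_V: "1 / (2 * real n) * A = m\<^sup>2 / 2 + real n / (real n - 1) * (1 / (2 * real n) * expectation V)"
    unfolding EV using n by (simp add: field_simps power2_eq_square)
  have "0 \<le> expectation V"
    unfolding V_def[abs_def] by (intro integral_nonneg_AE) (simp add: sum_nonneg)
  have identity: "(\<integral>w. H_objective n (\<lambda>_. 1 / real n) 1 l N (S w) x \<partial>M)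
       = 1 / (2 * real n) * (\<Sum>i=1..n. (\<integral>w. local_loss l N (S w) i x \<partial>M)\<^sup>2)
         + real n / (real n - 1) *
           (\<integral>w. 1 / (2 * real n) *
              (\<Sum>i=1..n. (local_loss l N (S w) i x - average_loss n l N (S w) x)\<^sup>2) \<partial>M)"
    unfolding f_def[symmetric] V_def[symmetric] EH EH_V using n mean by simp
  have bound: "(C \<le> 1 \<longrightarrow>
             (\<integral>w. H_objective n (\<lambda>_. 1 / real n) 1 l N (S w) x \<partial>M)
               \<le> (\<integral>w. L_objective n (real n / (C * (real n - 1))) l N (S w) x \<partial>M))
          \<and> (\<integral>w. H_objective n (\<lambda>_. 1 / real n) 1 l N (S w) x \<partial>M)
               \<le> C * (\<integral>w. L_objective n (real n / (C * (real n - 1))) l N (S w) x \<partial>M)"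
    if C: "C > 0" and "0 \<le> m" "m \<le> C" for C
  proof -
    let ?L = "\<integral>w. L_objective n (real n / (C * (real n - 1))) l N (S w) x \<partial>M"
    \<comment> \<open>The factor \<open>C\<close> cancels the \<open>1 / C\<close> in lambda, so the
      deviation term is exactly the one in \<open>EH_V\<close> and only \<open>m\<^sup>2 / 2\<close>
      against \<open>C * m\<close> remains.\<close>
    have "C * ?L = C * m + real n / (real n - 1) * (1 / (2 * real n) * expectation V)"
      unfolding EL using C n by (simp add: field_simps)
    moreover have "m\<^sup>2 / 2 \<le> C * m"
    proof -
      have "m * m \<le> C * m" "0 \<le> m * m"
        using that by (auto intro: mult_right_mono)
      then show ?thesis
        unfolding power2_eq_square by linarith
    qed
    ultimately have le: "(\<integral>w. H_objective n (\<lambda>_. 1 / real n) 1 l N (S w) x \<partial>M) \<le> C * ?L"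
      unfolding EH EH_V by simp
    \<comment> \<open>Nonnegativity is what allows \<open>C * ?L\<close> to be enlarged to
      \<open>?L\<close> when \<open>C \<le> 1\<close>.\<close>
    have "0 \<le> ?L"
      unfolding EL using that n \<open>0 \<le> expectation V\<close> by simp
    then have "C * ?L \<le> ?L" if "C \<le> 1"
      using mult_right_mono[OF that] by simp
    with le show ?thesis
      by (intro conjI impI) (rule order_trans)
  qed
  show ?thesis
  proof (intro conjI[OF identity] allI impI)
    fix C :: real
    assume "C > 0"
      and "\<forall>i\<in>{1..n}. 0 \<le> (\<integral>w. local_loss l N (S w) i x \<partial>M)
                   \<and> (\<integral>w. local_loss l N (S w) i x \<partial>M) \<le> C"
    \<comment> \<open>All clients have mean \<open>m\<close>, so the bounds on \<open>m\<close> can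
      be read off client 1.\<close>
    moreover have "1 \<in> {1..n}"
      using assms(1) by simp
    ultimately show "(C \<le> 1 \<longrightarrow>
             (\<integral>w. H_objective n (\<lambda>_. 1 / real n) 1 l N (S w) x \<partial>M)
               \<le> (\<integral>w. L_objective n (real n / (C * (real n - 1))) l N (S w) x \<partial>M))
          \<and> (\<integral>w. H_objective n (\<lambda>_. 1 / real n) 1 l N (S w) x \<partial>M)
               \<le> C * (\<integral>w. L_objective n (real n / (C * (real n - 1))) l N (S w) x \<partial>M)"
      using mean[of 1] unfolding f_def[symmetric] by (intro bound) auto
  qed
qed

end
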